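(* Let $s$ be a primitive string over $\Sigma=\{c_1,\dots,c_\sigma\}$ and suppose we are given $BWT_*(s)$ with constant time rank support, and the set of permutations $\{\pi_x\}$ used to compute the matrix $M_*(s)$. Then, given any string $x=x_1x_2\cdots x_p$, the range of rows $\mathrm{Rng}(x)$ prefixed by $x$ can be computed in $\mathcal{O}(\sigma p^2)$ time and $\mathcal{O}(\sigma p)$ space.
   Context: A string is primitive if all its cyclic rotations are distinct. A context adaptive BWT: for every string $x$ an ordering (permutation) $\pi_x$ of $\Sigma$ is fixed; the matrix $M_*(s)$ has as rows all cyclic rotations of $s$, sorted so that, for two distinct rotations whose longest common prefix is $x$, the one whose $(|x|+1)$-st symbol is smaller according to $\pi_x$ comes first; $BWT_*(s)$ is the last column of $M_*(s)$. For a string $x$, $\mathrm{Rng}(x)=[b_x,\ell_x]$ means row $i$ of $M_*(s)$ is prefixed by $x$ iff $b_x\le i<b_x+\ell_x$ ($[0,0]$ if none). Constant time rank support means that $\mathrm{rank}_c(BWT_*(s),i)$, the number of occurrences of $c$ in the first $i$ symbols, can be answered in $\mathcal{O}(1)$ time. Computation model: word RAM with word size $w$, $\sigma=w^{\mathcal{O}(1)}$; space is measured in words. *)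

theory Defs
  imports
    "HOL-Library.Sublist"
    "HOL-Combinatorics.Multiset_Permutations"
begin

unbundle bit_operations_syntax

section \<open>Context adaptive Burrows-Wheeler transforms\<close>

text \<open>
  The alphabet \<open>{c\<^sub>1, \<dots>, c\<^sub>\<sigma>}\<close> is encoded as \<open>{..<\<sigma>}\<close>. The ordering \<open>\<pi>\<^sub>x\<close> is the list
  \<open>\<pi> x\<close> of all symbols from smallest to largest.
\<close>

definition context_orderings :: "nat \<Rightarrow> (nat list \<Rightarrow> nat list) \<Rightarrow> bool" where
  "context_orderings \<sigma> \<pi> \<longleftrightarrow>
     (\<forall>x. set x \<subseteq> {..<\<sigma>} \<longrightarrow> \<pi> x \<in> permutations_of_set {..<\<sigma>})"

definition rotations :: "'a list \<Rightarrow> 'a list list" where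
  "rotations s = map (\<lambda>k. rotate k s) [0..<length s]"

definition primitive :: "'a list \<Rightarrow> bool" where
  "primitive s \<longleftrightarrow> distinct (rotations s)"

definition precedes :: "'a list \<Rightarrow> 'a \<Rightarrow> 'a \<Rightarrow> bool" where
  "precedes L a b \<longleftrightarrow> (\<exists>i j. i < j \<and> j < length L \<and> L ! i = a \<and> L ! j = b)"

definition ctx_less :: "('a list \<Rightarrow> 'a list) \<Rightarrow> 'a list \<Rightarrow> 'a list \<Rightarrow> bool" where
  "ctx_less \<pi> u v \<longleftrightarrow> u \<noteq> v \<and>
     (let x = longest_common_prefix u v
      in precedes (\<pi> x) (u ! length x) (v ! length x))"

definition bwt_matrix :: "('a list \<Rightarrow> 'a list) \<Rightarrow> 'a list \<Rightarrow> 'a list list" where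
  "bwt_matrix \<pi> s =
     (THE M. mset M = mset (rotations s) \<and> sorted_wrt (ctx_less \<pi>) M)"

definition bwt :: "('a list \<Rightarrow> 'a list) \<Rightarrow> 'a list \<Rightarrow> 'a list" where
  "bwt \<pi> s = map last (bwt_matrix \<pi> s)"

definition rank :: "'a \<Rightarrow> 'a list \<Rightarrow> nat \<Rightarrow> nat" where
  "rank c L i = count_list (take i L) c"

text \<open>\<open>is_Rng M x b l\<close> says that the range \<open>[b, l]\<close> is \<open>Rng(x)\<close>; \<open>l\<close> is a length, not an endpoint.\<close>

definition is_Rng :: "'a list list \<Rightarrow> 'a list \<Rightarrow> nat \<Rightarrow> nat \<Rightarrow> bool" where
  "is_Rng M x b l \<longleftrightarrow>
     (if \<exists>i < length M. prefix x (M ! i)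
      then \<forall>i. (i < length M \<and> prefix x (M ! i)) \<longleftrightarrow> (b \<le> i \<and> i < b + l)
      else b = 0 \<and> l = 0)"

section \<open>Word RAM\<close>

text \<open>
  Structured programs over finitely many registers of type \<open>'r\<close> and a random access memory. All
  primitive instructions and all tests take unit time. Besides its own memory, a program can only
  consult the given data, through three read-only instructions:

  \<^item> \<open>Symbol d i\<close> reads symbol number \<open>i\<close> (from 0) of the query string \<open>x\<close>;
  \<^item> \<open>Rank d c i\<close> asks for \<open>rank\<^sub>c(BWT, i)\<close>;
  \<^item> \<open>Perm d i j k\<close> asks for the \<open>k\<close>-th smallest symbol (from 0) with respect to \<open>\<pi>\<^sub>y\<close>, where the
    context \<open>y\<close> is the factor of the query string from position \<open>i\<close> inclusive to position \<open>j\<close>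
    exclusive. A context is thus named by two words.
\<close>

datatype binop = Add | Sub | Mul | Div | Mod | And | Or | Xor | Shl | Shr

datatype 'r test = Less 'r 'r | Equal 'r 'r

datatype (regs: 'r) prog =
    Skip
  | Const 'r nat
  | Op binop 'r 'r 'r
  | Load 'r 'r
  | Store 'r 'r
  | Symbol 'r 'r
  | Rank 'r 'r 'r
  | Perm 'r 'r 'r 'r
  | Seq "'r prog" "'r prog"
  | If "'r test" "'r prog" "'r prog"
  | While "'r test" "'r prog"

fun binop_val :: "nat \<Rightarrow> binop \<Rightarrow> nat \<Rightarrow> nat \<Rightarrow> nat" where
  "binop_val w Add a b = (a + b) mod 2 ^ w"
| "binop_val w Sub a b = (a + 2 ^ w - b) mod 2 ^ w"
| "binop_val w Mul a b = (a * b) mod 2 ^ w"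
| "binop_val w Div a b = a div b"
| "binop_val w Mod a b = a mod b"
| "binop_val w And a b = a AND b"
| "binop_val w Or a b = a OR b"
| "binop_val w Xor a b = a XOR b"
| "binop_val w Shl a b = push_bit b a mod 2 ^ w"
| "binop_val w Shr a b = drop_bit b a"

fun test_val :: "'r test \<Rightarrow> ('r \<Rightarrow> nat) \<Rightarrow> bool" where
  "test_val (Less a b) R \<longleftrightarrow> R a < R b"
| "test_val (Equal a b) R \<longleftrightarrow> R a = R b"

text \<open>
  \<open>exec w m \<sigma> B \<pi> x P (R, H) t (R', H')\<close>: on a machine with words of \<open>w\<close> bits and \<open>m\<close> memory
  cells, and with \<open>B\<close> in the role of the transformed string, program \<open>P\<close> started with register
  contents \<open>R\<close> and memory \<open>H\<close> halts after \<open>t\<close> steps with contents \<open>R'\<close> and \<open>H'\<close>. There is no rule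
  for memory accesses outside the \<open>m\<close> cells or for queries with arguments out of range, so such
  programs do not halt.
\<close>

type_synonym 'r state = "('r \<Rightarrow> nat) \<times> (nat \<Rightarrow> nat)"

inductive exec ::
  "nat \<Rightarrow> nat \<Rightarrow> nat \<Rightarrow> nat list \<Rightarrow> (nat list \<Rightarrow> nat list) \<Rightarrow> nat list \<Rightarrow>
     'r prog \<Rightarrow> 'r state \<Rightarrow> nat \<Rightarrow> 'r state \<Rightarrow> bool"
  for w m \<sigma> :: nat and B :: "nat list" and \<pi> :: "nat list \<Rightarrow> nat list" and x :: "nat list"
where
  Skip: "exec w m \<sigma> B \<pi> x Skip (R, H) 1 (R, H)"
| Const: "exec w m \<sigma> B \<pi> x (Const d a) (R, H) 1 (R(d := a mod 2 ^ w), H)"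
| Op: "exec w m \<sigma> B \<pi> x (Op f d a b) (R, H) 1 (R(d := binop_val w f (R a) (R b)), H)"
| Load: "R a < m \<Longrightarrow> exec w m \<sigma> B \<pi> x (Load d a) (R, H) 1 (R(d := H (R a)), H)"
| Store: "R a < m \<Longrightarrow> exec w m \<sigma> B \<pi> x (Store a b) (R, H) 1 (R, H(R a := R b))"
| Symbol: "R i < length x \<Longrightarrow>
    exec w m \<sigma> B \<pi> x (Symbol d i) (R, H) 1 (R(d := x ! R i), H)"
| Rank: "R c < \<sigma> \<Longrightarrow> R i \<le> length B \<Longrightarrow>
    exec w m \<sigma> B \<pi> x (Rank d c i) (R, H) 1 (R(d := rank (R c) B (R i)), H)"
| Perm: "R i \<le> R j \<Longrightarrow> R j \<le> length x \<Longrightarrow> R k < \<sigma> \<Longrightarrow>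
    exec w m \<sigma> B \<pi> x (Perm d i j k) (R, H) 1
      (R(d := \<pi> (drop (R i) (take (R j) x)) ! R k), H)"
| Seq: "exec w m \<sigma> B \<pi> x P S t S' \<Longrightarrow> exec w m \<sigma> B \<pi> x Q S' t' S'' \<Longrightarrow>
    exec w m \<sigma> B \<pi> x (Seq P Q) S (t + t') S''"
| IfTrue: "test_val b (fst S) \<Longrightarrow> exec w m \<sigma> B \<pi> x P S t S' \<Longrightarrow>
    exec w m \<sigma> B \<pi> x (If b P Q) S (1 + t) S'"
| IfFalse: "\<not> test_val b (fst S) \<Longrightarrow> exec w m \<sigma> B \<pi> x Q S t S' \<Longrightarrow>
    exec w m \<sigma> B \<pi> x (If b P Q) S (1 + t) S'"
| WhileFalse: "\<not> test_val b (fst S) \<Longrightarrow> exec w m \<sigma> B \<pi> x (While b P) S 1 S"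
| WhileTrue: "test_val b (fst S) \<Longrightarrow> exec w m \<sigma> B \<pi> x P S t S' \<Longrightarrow>
    exec w m \<sigma> B \<pi> x (While b P) S' t' S'' \<Longrightarrow>
    exec w m \<sigma> B \<pi> x (While b P) S (1 + t + t') S''"

text \<open>
  Registers 0, 1, 2 initially hold \<open>|s|\<close>, \<open>\<sigma>\<close> and \<open>|x|\<close>; all other registers and the memory hold
  arbitrary words. The two components of \<open>Rng(x)\<close> are returned in registers 0 and 1. Space counts
  the memory cells and the registers, but not the given read-only data.
\<close>

definition computes_Rng ::
  "nat prog \<Rightarrow> nat \<Rightarrow> nat \<Rightarrow> nat list \<Rightarrow> (nat list \<Rightarrow> nat list) \<Rightarrow> nat list \<Rightarrow> nat \<Rightarrow> nat \<Rightarrow> bool"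
where
  "computes_Rng P w \<sigma> s \<pi> x time space \<longleftrightarrow>
     (\<exists>m. m + card (regs P) \<le> space \<and>
       (\<forall>R H. (\<forall>r. R r < 2 ^ w) \<and> (\<forall>a. H a < 2 ^ w) \<and>
              R 0 = length s \<and> R 1 = \<sigma> \<and> R 2 = length x \<longrightarrow>
          (\<exists>t R' H'. exec w m \<sigma> (bwt \<pi> s) \<pi> x P (R, H) t (R', H') \<and> t \<le> time \<and>
                     is_Rng (bwt_matrix \<pi> s) x (R' 0) (R' 1))))"

text \<open>
  The machine must be able to hold \<open>|s|\<close>, \<open>\<sigma>\<close> and \<open>|x|\<close> in a word and to address \<open>\<sigma>\<close> words for
  each position of \<open>s\<close>.
\<close>

definition word_size_ok :: "nat \<Rightarrow> nat \<Rightarrow> nat list \<Rightarrow> nat list \<Rightarrow> bool" where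
  "word_size_ok w \<sigma> s x \<longleftrightarrow> \<sigma> * (length s + 1) < 2 ^ w \<and> length x < 2 ^ w"

end

theory Submission
  imports Defs
begin

text \<open>
  Rotating by one position maps the rows starting with \<open>c y\<close> bijectively onto the rows that start
  with \<open>y\<close> and end with \<open>c\<close>, so two rank queries at the ends of \<open>Rng(y)\<close> give the width of
  \<open>Rng(c y)\<close>. Its start is not available this way, because \<open>\<pi>\<close> differs from context to context.
  Instead, \<open>Rng(y)\<close> is the concatenation of the ranges \<open>Rng(y d)\<close> with \<open>d\<close> in the order \<open>\<pi> y\<close>, so
  the start of \<open>Rng(y c)\<close> is the start of \<open>Rng(y)\<close> plus the widths of \<open>Rng(y d)\<close> for the \<open>d\<close>
  before \<open>c\<close>. For \<open>j = 0, \<dots>, p - 1\<close> and \<open>i = j, \<dots>, 0\<close> the program computes (counting from 0) the ranges of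
  \<open>x\<^sub>i \<dots> x\<^bsub>j-1\<^esub> c\<close> for all symbols \<open>c\<close>: the widths come from the ranges for \<open>i + 1\<close>, and the start
  for \<open>x\<^sub>i \<dots> x\<^bsub>j-1\<^esub>\<close> itself was found in round \<open>j - 1\<close>.
\<close>

subsection \<open>Sorting by a strict total order\<close>

text \<open>Needed for the definite description in \<open>bwt_matrix\<close>. Counting predecessors
  turns \<open>r\<close> into a numeric key that is injective on \<open>set xs\<close>, so existence
  and uniqueness both come from sorting by a key.\<close>

lemma ex1_sorted_wrt:
  assumes dist: "distinct xs"
    and irrefl: "\<And>u. u \<in> set xs \<Longrightarrow> \<not> r u u"
    and trans: "\<And>u v z. u \<in> set xs \<Longrightarrow> v \<in> set xs \<Longrightarrow> z \<in> set xs \<Longrightarrow> r u v \<Longrightarrow> r v z \<Longrightarrow> r u z"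
    and total: "\<And>u v. u \<in> set xs \<Longrightarrow> v \<in> set xs \<Longrightarrow> u \<noteq> v \<Longrightarrow> r u v \<or> r v u"
  shows "\<exists>!ys. mset ys = mset xs \<and> sorted_wrt r ys"
proof -
  define f where "f u = card {v \<in> set xs. r v u}" for u
  have f_less: "f u < f v" if "u \<in> set xs" "v \<in> set xs" "r u v" for u v
    unfolding f_def
  proof (rule psubset_card_mono)
    show "{z \<in> set xs. r z u} \<subset> {z \<in> set xs. r z v}"
      using that irrefl trans by blast
  qed simp
  have inj: "inj_on f (set xs)"
    using f_less total by (metis inj_onI less_irrefl)
  show ?thesis
  proof (rule ex1I)
    let ?ys = "sort_key f xs"
    have "sorted_wrt r ?ys"
      unfolding sorted_wrt_iff_nth_less
    proof (intro allI impI)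
      fix i j assume ij: "i < j" "j < length ?ys"
      have mem: "?ys ! i \<in> set xs" "?ys ! j \<in> set xs"
        using ij by (metis less_trans nth_mem set_sort)+
      have "?ys ! i \<noteq> ?ys ! j"
        using ij dist by (metis distinct_sort less_trans nat_neq_iff nth_eq_iff_index_eq)
      moreover have "f (?ys ! i) \<le> f (?ys ! j)"
        using sorted_sort_key[of f xs] ij by (simp add: sorted_iff_nth_mono)
      ultimately show "r (?ys ! i) (?ys ! j)"
        using mem total f_less by (metis leD)
    qed
    then show "mset ?ys = mset xs \<and> sorted_wrt r ?ys"
      by simp
  next
    fix ys assume ys: "mset ys = mset xs \<and> sorted_wrt r ys"
    then have "set ys = set xs"
      by (metis mset_eq_setD)
    then have "sorted (map f ys)"
      unfolding sorted_wrt_map using ys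
      by (auto intro!: sorted_wrt_mono_rel[of ys r] less_imp_le f_less)
    then show "ys = sort_key f xs"
      using sort_key_inj_key_eq[OF _ inj] ys by metis
  qed
qed

text \<open>The hypothesis forbids an element with \<open>P\<close> after one without, so the
  elements with \<open>P\<close> form an initial segment.\<close>

lemma append_filter_eq:
  assumes "sorted_wrt (\<lambda>u v. P v \<longrightarrow> P u) xs"
  shows "filter P xs @ filter (\<lambda>u. \<not> P u) xs = xs"
  using assms by (induction xs) (auto simp: filter_empty_conv filter_id_conv)

subsection \<open>Context orders\<close>

lemma precedes_irrefl: "distinct L \<Longrightarrow> \<not> precedes L a a"
  unfolding precedes_def by (metis less_irrefl less_trans nth_eq_iff_index_eq)

lemma precedes_trans:
  assumes "distinct L" "precedes L a b" "precedes L b c"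
  shows "precedes L a c"
proof -
  obtain i j where ij: "i < j" "j < length L" "L ! i = a" "L ! j = b"
    using assms(2) by (auto simp: precedes_def)
  obtain k l where kl: "k < l" "l < length L" "L ! k = b" "L ! l = c"
    using assms(3) by (auto simp: precedes_def)
  have "j = k"
    using ij kl assms(1) by (metis less_trans nth_eq_iff_index_eq)
  then show ?thesis
    unfolding precedes_def using ij kl by (metis less_trans)
qed

lemma precedes_total:
  assumes "a \<in> set L" "b \<in> set L" "a \<noteq> b"
  shows "precedes L a b \<or> precedes L b a"
  using assms unfolding precedes_def in_set_conv_nth by (metis nat_neq_iff)

lemma precedes_Cons:
  "precedes (a # L) b c \<longleftrightarrow> (b = a \<and> c \<in> set L) \<or> precedes L b c"
proof
  assume "precedes (a # L) b c"
  then obtain i j where ij: "i < j" "j < length (a # L)" "(a # L) ! i = b" "(a # L) ! j = c"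
    by (auto simp: precedes_def)
  then obtain j' where j': "j = Suc j'"
    by (cases j) auto
  show "(b = a \<and> c \<in> set L) \<or> precedes L b c"
  proof (cases i)
    case 0
    then show ?thesis using ij j' by auto
  next
    case (Suc i')
    then show ?thesis using ij j' by (auto simp: precedes_def)
  qed
next
  assume "(b = a \<and> c \<in> set L) \<or> precedes L b c"
  then show "precedes (a # L) b c"
  proof
    assume "b = a \<and> c \<in> set L"
    then obtain j where "j < length L" "L ! j = c" "b = a"
      by (auto simp: in_set_conv_nth)
    then show ?thesis
      unfolding precedes_def by (intro exI[of _ 0] exI[of _ "Suc j"]) auto
  next
    assume "precedes L b c"
    then obtain i j where "i < j" "j < length L" "L ! i = b" "L ! j = c"
      by (auto simp: precedes_def)
    then show ?thesis
      unfolding precedes_def by (intro exI[of _ "Suc i"] exI[of _ "Suc j"]) auto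
  qed
qed

text \<open>Bucket decomposition by induction on \<open>L\<close>: nothing precedes the head
  \<open>a\<close>, so the elements with key \<open>a\<close> come first, and the others stay sorted
  with respect to the tail.\<close>

lemma concat_filter_key_eq:
  assumes "distinct L" and "\<And>u. u \<in> set xs \<Longrightarrow> f u \<in> set L"
    and "sorted_wrt (\<lambda>u v. f u = f v \<or> precedes L (f u) (f v)) xs"
  shows "concat (map (\<lambda>c. filter (\<lambda>u. f u = c) xs) L) = xs"
  using assms
proof (induction L arbitrary: xs)
  case Nil
  then show ?case by (cases xs) auto
next
  case (Cons a L)
  let ?ys = "filter (\<lambda>u. f u \<noteq> a) xs"
  have not_prec: "\<not> precedes L b a" for b
    using Cons.prems(1) by (auto simp: precedes_def)
  have "sorted_wrt (\<lambda>u v. f v = a \<longrightarrow> f u = a) xs"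
    by (rule sorted_wrt_mono_rel[OF _ Cons.prems(3)])
       (use Cons.prems(1) not_prec in \<open>auto simp: precedes_Cons\<close>)
  then have split: "filter (\<lambda>u. f u = a) xs @ ?ys = xs"
    by (rule append_filter_eq)
  have "concat (map (\<lambda>c. filter (\<lambda>u. f u = c) ?ys) L) = ?ys"
  proof (rule Cons.IH)
    show "distinct L" using Cons.prems(1) by simp
    show "f u \<in> set L" if "u \<in> set ?ys" for u
      using that Cons.prems(2)[of u] by auto
    have "sorted_wrt (\<lambda>u v. f u = f v \<or> precedes (a # L) (f u) (f v)) ?ys"
      using Cons.prems(3) by (rule sorted_wrt_filter)
    then show "sorted_wrt (\<lambda>u v. f u = f v \<or> precedes L (f u) (f v)) ?ys"
      by (rule sorted_wrt_mono_rel[rotated]) (auto simp: precedes_Cons)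
  qed
  also have "map (\<lambda>c. filter (\<lambda>u. f u = c) ?ys) L = map (\<lambda>c. filter (\<lambda>u. f u = c) xs) L"
    using Cons.prems(1) by (auto intro!: filter_cong)
  finally have "concat (map (\<lambda>c. filter (\<lambda>u. f u = c) xs) L) = ?ys" .
  then show ?case
    using split by simp
qed

lemma prefix_iff_take: "prefix v u \<longleftrightarrow> take (length v) u = v"
  by (metis append_eq_conv_conj prefix_def take_is_prefix)

text \<open>A witness \<open>k\<close> is necessarily the length of the longest common prefix: an
  ordering without repetitions is irreflexive, so \<open>u ! k\<close> and \<open>v ! k\<close>
  differ. In this form positions of first difference can be compared directly, as transitivity
  requires.\<close>

lemma ctx_less_iff:
  assumes len: "length u = length v" and dist: "\<And>k. distinct (\<pi> (take k u))"
  shows "ctx_less \<pi> u v \<longleftrightarrow>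
    (\<exists>k<length u. take k u = take k v \<and> precedes (\<pi> (take k u)) (u ! k) (v ! k))"
proof
  assume less: "ctx_less \<pi> u v"
  let ?x = "longest_common_prefix u v" and ?k = "length (longest_common_prefix u v)"
  have x: "take ?k u = ?x" "take ?k v = ?x"
    using longest_common_prefix_prefix1[of u v] longest_common_prefix_prefix2[of u v]
    unfolding prefix_iff_take .
  have "?k < length u"
  proof (rule ccontr)
    assume "\<not> ?k < length u"
    then have "u = v" using x len by simp
    then show False using less by (simp add: ctx_less_def)
  qed
  then show "\<exists>k<length u. take k u = take k v \<and> precedes (\<pi> (take k u)) (u ! k) (v ! k)"
    using less x by (intro exI[of _ ?k]) (simp add: ctx_less_def Let_def)
next
  assume "\<exists>k<length u. take k u = take k v \<and> precedes (\<pi> (take k u)) (u ! k) (v ! k)"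
  then obtain k where k: "k < length u" "take k u = take k v"
    "precedes (\<pi> (take k u)) (u ! k) (v ! k)" by blast
  have neq: "u ! k \<noteq> v ! k"
    using k(3) precedes_irrefl dist by metis
  let ?x = "longest_common_prefix u v"
  have pre: "prefix ?x u" "prefix ?x v"
    by (rule longest_common_prefix_prefix1 longest_common_prefix_prefix2)+
  have "prefix (take k u) ?x"
    by (metis k(2) longest_common_prefix_max_prefix take_is_prefix)
  then have ge: "k \<le> length ?x"
    using k(1) by (auto dest: prefix_length_le)
  have "\<not> k < length ?x"
    using pre neq unfolding prefix_iff_take by (metis nth_take)
  then have "length ?x = k" using ge by simp
  moreover from this have "?x = take k u"
    using pre(1) unfolding prefix_iff_take by simp
  ultimately show "ctx_less \<pi> u v"
    using k neq by (auto simp: ctx_less_def)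
qed

subsection \<open>Rows of the matrix\<close>

text \<open>\<open>rotate1\<close> shifts the rotation index by one, and the last index wraps around
  because \<open>rotate (length s) s = s\<close>.\<close>

lemma mset_rotations_rotate1: "image_mset rotate1 (mset (rotations s)) = mset (rotations s)"
proof (cases "length s")
  case 0
  then show ?thesis by (simp add: rotations_def)
next
  case (Suc n)
  have "map rotate1 (rotations s) = map (\<lambda>k. rotate k s) [Suc 0..<Suc (Suc n)]"
    unfolding rotations_def Suc by (simp add: map_Suc_upt[symmetric] del: map_Suc_upt upt_Suc)
  also have "\<dots> = map (\<lambda>k. rotate k s) [Suc 0..<Suc n] @ [rotate (length s) s]"
    using Suc by simp
  also have "mset \<dots> = mset (rotate 0 s # map (\<lambda>k. rotate k s) [Suc 0..<Suc n])"
    by (simp del: upt_Suc)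
  also have "rotate 0 s # map (\<lambda>k. rotate k s) [Suc 0..<Suc n] = rotations s"
    unfolding rotations_def Suc by (simp add: upt_conv_Cons del: upt_Suc)
  finally show ?thesis by simp
qed

text \<open>Comparing lengths after filtering both sides leaves no room for elements with
  \<open>P\<close> in \<open>ys\<close> or \<open>zs\<close>.\<close>

lemma append_filter_appendD:
  assumes "xs = ys @ filter P xs @ zs"
  shows "filter P ys = []" "filter P zs = []"
proof -
  have "filter P xs = filter P ys @ filter P xs @ filter P zs"
    by (subst assms) simp
  from arg_cong[OF this, of length]
  have "length (filter P ys) = 0 \<and> length (filter P zs) = 0"
    unfolding length_append by linarith
  then show "filter P ys = []" "filter P zs = []" by simp_all
qed

section \<open>Well-definedness of the sorted matrix\<close>

locale ctx_bwt =
  fixes \<sigma> :: nat and \<pi> :: "nat list \<Rightarrow> nat list" and s :: "nat list"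
  assumes alphabet: "set s \<subseteq> {..<\<sigma>}"
    and primitive: "primitive s"
    and orderings: "context_orderings \<sigma> \<pi>"
begin

abbreviation M :: "nat list list" where
  "M \<equiv> bwt_matrix \<pi> s"

lemma set_ordering: "set y \<subseteq> {..<\<sigma>} \<Longrightarrow> set (\<pi> y) = {..<\<sigma>}"
  and distinct_ordering: "set y \<subseteq> {..<\<sigma>} \<Longrightarrow> distinct (\<pi> y)"
  using orderings by (auto simp: context_orderings_def permutations_of_set_def)

lemma length_ordering: "set y \<subseteq> {..<\<sigma>} \<Longrightarrow> length (\<pi> y) = \<sigma>"
  using set_ordering distinct_ordering by (metis card_lessThan distinct_card)

lemma rotations_props:
  assumes "u \<in> set (rotations s)"
  shows "length u = length s" "set u \<subseteq> {..<\<sigma>}"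
  using assms alphabet by (auto simp: rotations_def)

lemma ctx_less_rotations_iff:
  assumes "u \<in> set (rotations s)" "v \<in> set (rotations s)"
  shows "ctx_less \<pi> u v \<longleftrightarrow>
    (\<exists>k<length s. take k u = take k v \<and> precedes (\<pi> (take k u)) (u ! k) (v ! k))"
proof -
  have "distinct (\<pi> (take k u))" for k
    by (meson assms(1) distinct_ordering order_trans rotations_props(2) set_take_subset)
  then show ?thesis
    using ctx_less_iff[of u v \<pi>] rotations_props(1)[OF assms(1)] rotations_props(1)[OF assms(2)]
    by simp
qed

lemma bwt_matrix_props: "mset M = mset (rotations s) \<and> sorted_wrt (ctx_less \<pi>) M"
proof -
  have "\<exists>!M. mset M = mset (rotations s) \<and> sorted_wrt (ctx_less \<pi>) M"
  proof (rule ex1_sorted_wrt)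
    show "distinct (rotations s)"
      using primitive by (simp add: primitive_def)
    show "\<not> ctx_less \<pi> u u" for u
      by (simp add: ctx_less_def)
  next
    fix u v z
    assume mem: "u \<in> set (rotations s)" "v \<in> set (rotations s)" "z \<in> set (rotations s)"
      and less: "ctx_less \<pi> u v" "ctx_less \<pi> v z"
    obtain k where k: "k < length s" "take k u = take k v" "precedes (\<pi> (take k u)) (u ! k) (v ! k)"
      using less(1) ctx_less_rotations_iff[OF mem(1,2)] by blast
    obtain l where l: "l < length s" "take l v = take l z" "precedes (\<pi> (take l v)) (v ! l) (z ! l)"
      using less(2) ctx_less_rotations_iff[OF mem(2,3)] by blast
    have cut: "take i a = take i b \<and> (i < j \<longrightarrow> a ! i = b ! i)"
      if "take j a = take j b" "i \<le> j" for i j :: nat and a b :: "nat list"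
      using that by (metis min_absorb1 nth_take take_take)
    \<comment> \<open>The earlier of the two first differences decides between \<open>u\<close> and
      \<open>z\<close>; if they coincide, transitivity of the common ordering does.\<close>
    consider "k < l" | "l < k" | "k = l" by linarith
    then have "\<exists>i<length s. take i u = take i z \<and> precedes (\<pi> (take i u)) (u ! i) (z ! i)"
    proof cases
      case 1
      then show ?thesis
        using k cut[OF l(2), of k] by (intro exI[of _ k]) auto
    next
      case 2
      then show ?thesis
        using l cut[OF k(2), of l] by (intro exI[of _ l]) auto
    next
      case 3
      have "distinct (\<pi> (take k u))"
        by (meson mem(1) distinct_ordering order_trans rotations_props(2) set_take_subset)
      then show ?thesis
        using k l 3 by (intro exI[of _ k]) (auto intro: precedes_trans)
    qed
    then show "ctx_less \<pi> u z"
      using ctx_less_rotations_iff[OF mem(1,3)] by blast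
  next
    fix u v
    assume mem: "u \<in> set (rotations s)" "v \<in> set (rotations s)" and neq: "u \<noteq> v"
    define k where "k = (LEAST k. k < length s \<and> u ! k \<noteq> v ! k)"
    have len: "length u = length s" "length v = length s"
      using mem rotations_props(1) by auto
    have "\<exists>k. k < length s \<and> u ! k \<noteq> v ! k"
      using neq len by (metis nth_equalityI)
    from LeastI_ex[OF this] have k: "k < length s" "u ! k \<noteq> v ! k"
      by (auto simp: k_def)
    have "u ! i = v ! i" if "i < k" for i
      using not_less_Least[OF that[unfolded k_def]] that k(1) by auto
    then have eq: "take k u = take k v"
      using k(1) len by (intro nth_equalityI) auto
    have "set (take k u) \<subseteq> {..<\<sigma>}"
      by (meson mem(1) order_trans rotations_props(2) set_take_subset)
    moreover have "u ! k \<in> {..<\<sigma>}" "v ! k \<in> {..<\<sigma>}"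
      using k(1) len mem rotations_props(2) by (metis nth_mem subsetD)+
    ultimately have "precedes (\<pi> (take k u)) (u ! k) (v ! k) \<or> precedes (\<pi> (take k u)) (v ! k) (u ! k)"
      using k(2) set_ordering by (intro precedes_total) auto
    then show "ctx_less \<pi> u v \<or> ctx_less \<pi> v u"
      using ctx_less_rotations_iff mem k(1) eq by metis
  qed
  then show ?thesis
    unfolding bwt_matrix_def by (rule theI')
qed

lemma mset_M: "mset M = mset (rotations s)"
  and sorted_M: "sorted_wrt (ctx_less \<pi>) M"
  using bwt_matrix_props by auto

lemma set_M: "set M = set (rotations s)"
  using mset_M by (metis mset_eq_setD)

lemma length_M [simp]: "length M = length s"
  using mset_M by (metis length_map length_upt minus_nat.diff_0 rotations_def size_mset)

lemma length_bwt [simp]: "length (bwt \<pi> s) = length s"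
  by (simp add: bwt_def)

subsection \<open>Blocks of rows with a common prefix\<close>

definition width :: "nat list \<Rightarrow> nat" where
  "width y = length (filter (prefix y) M)"

text \<open>The intended position of the block of \<open>y\<close>, in the form in which the program
  accumulates it. It makes sense for empty blocks too, whose starts the program also stores;
  \<open>block\<close> justifies it.\<close>

definition start :: "nat list \<Rightarrow> nat" where
  "start y = (\<Sum>i<length y. \<Sum>d\<leftarrow>takeWhile (\<lambda>d. d \<noteq> y ! i) (\<pi> (take i y)). width (take i y @ [d]))"

lemma start_Nil [simp]: "start [] = 0"
  by (simp add: start_def)

lemma start_snoc:
  "start (y @ [c]) = start y + (\<Sum>d\<leftarrow>takeWhile (\<lambda>d. d \<noteq> c) (\<pi> y). width (y @ [d]))"
  by (simp add: start_def nth_append)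

lemma start_snoc_nth:
  assumes "set y \<subseteq> {..<\<sigma>}" "k < \<sigma>"
  shows "start (y @ [\<pi> y ! k]) = start y + (\<Sum>d\<leftarrow>take k (\<pi> y). width (y @ [d]))"
proof -
  have "takeWhile (\<lambda>d. d \<noteq> \<pi> y ! k) (\<pi> y) = take k (\<pi> y)"
    using assms distinct_ordering length_ordering
    by (intro takeWhile_eq_take_P_nth) (auto simp: nth_eq_iff_index_eq)
  then show ?thesis by (simp add: start_snoc)
qed

lemma prefix_snoc_row_iff:
  assumes "u \<in> set M" "length y < length s"
  shows "prefix (y @ [c]) u \<longleftrightarrow> prefix y u \<and> u ! length y = c"
proof -
  have "length y < length u"
    using assms rotations_props(1)[of u] set_M by simp
  then show ?thesis
    by (auto simp: prefix_iff_take take_Suc_conv_app_nth)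
qed

text \<open>Rows that start with \<open>y\<close> first differ at position \<open>length y\<close>
  or later, so among them the next symbol, ordered by \<open>\<pi> y\<close>, is the primary sort
  key.\<close>

lemma concat_children:
  assumes y: "set y \<subseteq> {..<\<sigma>}" "length y < length s"
  shows "concat (map (\<lambda>c. filter (prefix (y @ [c])) M) (\<pi> y)) = filter (prefix y) M"
proof -
  let ?F = "filter (prefix y) M"
  have "concat (map (\<lambda>c. filter (\<lambda>u. u ! length y = c) ?F) (\<pi> y)) = ?F"
  proof (rule concat_filter_key_eq)
    show "distinct (\<pi> y)" using y distinct_ordering by blast
    show "u ! length y \<in> set (\<pi> y)" if "u \<in> set ?F" for u
    proof -
      have "u \<in> set (rotations s)" using that set_M by auto
      then show ?thesis
        using rotations_props[of u] y set_ordering[OF y(1)] by (auto simp: subset_iff)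
    qed
    have "sorted_wrt (ctx_less \<pi>) ?F"
      using sorted_M by (rule sorted_wrt_filter)
    then show "sorted_wrt (\<lambda>u v. u ! length y = v ! length y
        \<or> precedes (\<pi> y) (u ! length y) (v ! length y)) ?F"
    proof (rule sorted_wrt_mono_rel[rotated])
      fix u v assume uv: "u \<in> set ?F" "v \<in> set ?F" "ctx_less \<pi> u v"
      then have mem: "u \<in> set (rotations s)" "v \<in> set (rotations s)" using set_M by auto
      then obtain k where k: "k < length s" "take k u = take k v"
        "precedes (\<pi> (take k u)) (u ! k) (v ! k)"
        using uv(3) ctx_less_rotations_iff by blast
      have takes: "take (length y) u = y" "take (length y) v = y"
        using uv by (auto simp: prefix_def)
      have "distinct (\<pi> (take k u))"
        by (meson mem(1) distinct_ordering order_trans rotations_props(2) set_take_subset)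
      then have neq: "u ! k \<noteq> v ! k"
        using k(3) precedes_irrefl by metis
      \<comment> \<open>A first difference inside \<open>y\<close> is impossible; one beyond
        position \<open>length y\<close> means that the next symbols agree.\<close>
      consider "k < length y" | "k = length y" | "length y < k" by linarith
      then show "u ! length y = v ! length y \<or> precedes (\<pi> y) (u ! length y) (v ! length y)"
      proof cases
        case 1
        then show ?thesis using takes neq by (metis nth_take)
      next
        case 2
        then show ?thesis using k(3) takes by simp
      next
        case 3
        then show ?thesis using k(2) by (metis nth_take)
      qed
    qed
  qed
  moreover have "filter (\<lambda>u. u ! length y = c) ?F = filter (prefix (y @ [c])) M" for c
    unfolding filter_filter using prefix_snoc_row_iff[OF _ y(2)] by (auto intro!: filter_cong)
  ultimately show ?thesis by simp
qed

lemma sum_width_children: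
  assumes "set y \<subseteq> {..<\<sigma>}" "length y < length s"
  shows "(\<Sum>c\<leftarrow>\<pi> y. width (y @ [c])) = width y"
  using arg_cong[OF concat_children[OF assms], of length]
  by (simp add: width_def length_concat o_def)

text \<open>Induction by appending a symbol \<open>c\<close>: the block of \<open>y\<close> is the
  concatenation of its children's blocks, so what lies before the block of \<open>y @ [c]\<close> is
  \<open>A\<close> followed by the earlier siblings.\<close>

lemma block:
  assumes "set y \<subseteq> {..<\<sigma>}" "length y \<le> length s"
  shows "\<exists>A C. M = A @ filter (prefix y) M @ C \<and> length A = start y"
  using assms
proof (induction y rule: rev_induct)
  case Nil
  show ?case by (intro exI[of _ "[]"]) simp
next
  case (snoc c y)
  have y: "set y \<subseteq> {..<\<sigma>}" "length y < length s" using snoc.prems by auto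
  obtain A C where AC: "M = A @ filter (prefix y) M @ C" "length A = start y"
    using snoc y by auto
  obtain k where k: "k < \<sigma>" "\<pi> y ! k = c"
    using snoc.prems(1) set_ordering[OF y(1)] length_ordering[OF y(1)]
    by (metis in_set_conv_nth insert_subset list.set(2) set_append le_sup_iff)
  let ?G = "\<lambda>c. filter (prefix (y @ [c])) M"
  have "\<pi> y = take k (\<pi> y) @ c # drop (Suc k) (\<pi> y)"
    using k length_ordering[OF y(1)] by (metis id_take_nth_drop)
  then have "filter (prefix y) M =
      concat (map ?G (take k (\<pi> y))) @ ?G c @ concat (map ?G (drop (Suc k) (\<pi> y)))"
    by (subst concat_children[OF y, symmetric])
       (metis (no_types, lifting) concat.simps(2) concat_append list.simps(9) map_append)
  then have "M = (A @ concat (map ?G (take k (\<pi> y)))) @ ?G c @ (concat (map ?G (drop (Suc k) (\<pi> y))) @ C)"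
    by (subst AC(1)) simp
  moreover have "length (A @ concat (map ?G (take k (\<pi> y)))) = start (y @ [c])"
    using start_snoc_nth[OF y(1) k(1)] k AC(2) by (simp add: width_def length_concat o_def)
  ultimately show ?case by blast
qed

lemma start_width_le:
  assumes "set y \<subseteq> {..<\<sigma>}" "length y \<le> length s"
  shows "start y + width y \<le> length s"
proof -
  obtain A C where AC: "M = A @ filter (prefix y) M @ C" "length A = start y"
    using block[OF assms] by blast
  have "length s = start y + width y + length C"
    using arg_cong[OF AC(1), of length] AC(2) by (simp add: width_def)
  then show ?thesis by simp
qed

lemma nth_prefix_iff:
  assumes "set y \<subseteq> {..<\<sigma>}" "length y \<le> length s"
  shows "i < length M \<and> prefix y (M ! i) \<longleftrightarrow> start y \<le> i \<and> i < start y + width y"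
proof -
  let ?F = "filter (prefix y) M"
  obtain A C where AC: "M = A @ ?F @ C" "length A = start y"
    using block[OF assms] by blast
  \<comment> \<open>The middle segment is the whole filtered list, so no row outside it starts with
    \<open>y\<close>.\<close>
  have no: "filter (prefix y) A = []" "filter (prefix y) C = []"
    using append_filter_appendD[OF AC(1)] by auto
  have len: "length s = start y + width y + length C"
    using arg_cong[OF AC(1), of length] AC(2) by (simp add: width_def)
  have M_nth: "M ! i = (A @ ?F @ C) ! i"
    by (rule arg_cong[OF AC(1)])
  consider "i < start y" | "start y \<le> i" "i < start y + width y" | "start y + width y \<le> i"
    by linarith
  then show ?thesis
  proof cases
    case 1
    then have "M ! i = A ! i" using AC by (metis nth_append)
    then have "\<not> prefix y (M ! i)"
      using no(1) 1 AC(2) by (simp add: filter_empty_conv)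
    then show ?thesis using 1 by simp
  next
    case 2
    then have "M ! i = ?F ! (i - start y)"
      using AC(2) width_def unfolding M_nth by (auto simp: nth_append)
    moreover have "?F ! (i - start y) \<in> set ?F"
      using 2 by (intro nth_mem) (auto simp: width_def)
    ultimately have "prefix y (M ! i)" by auto
    then show ?thesis using 2 len by simp
  next
    case 3
    show ?thesis
    proof (cases "i < length M")
      case True
      then have "M ! i = C ! (i - start y - width y)"
        using AC(2) width_def 3 unfolding M_nth by (auto simp: nth_append)
      moreover have "C ! (i - start y - width y) \<in> set C"
        using 3 True len by (intro nth_mem) auto
      ultimately have "\<not> prefix y (M ! i)"
        using no(2) by (auto simp: filter_empty_conv)
      then show ?thesis using 3 by simp
    qed (use 3 in auto)
  qed
qed

lemma is_Rng_start_width: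
  assumes "set y \<subseteq> {..<\<sigma>}" "length y \<le> length s"
  shows "is_Rng M y (if width y = 0 then 0 else start y) (width y)"
proof (cases "width y = 0")
  case True
  then show ?thesis
    using nth_prefix_iff[OF assms] by (simp add: is_Rng_def)
next
  case False
  then have "\<exists>i<length M. prefix y (M ! i)"
    using nth_prefix_iff[OF assms, of "start y"] by auto
  then show ?thesis
    using nth_prefix_iff[OF assms] False by (simp add: is_Rng_def)
qed

lemma is_Rng_long:
  assumes "length s < length y"
  shows "is_Rng M y 0 0"
proof -
  have "\<not> prefix y (M ! i)" if "i < length M" for i
  proof -
    have "length (M ! i) = length s"
      using that rotations_props(1) set_M by (metis nth_mem)
    then show ?thesis using assms by (auto dest: prefix_length_le)
  qed
  then show ?thesis by (auto simp: is_Rng_def)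
qed

lemma width_Nil [simp]: "width [] = length s"
  by (simp add: width_def)

text \<open>LF mapping: rotating by one position turns the rows starting with \<open>c # y\<close> into the rows
  that start with \<open>y\<close> and end with \<open>c\<close>.\<close>

lemma width_Cons:
  assumes y: "set y \<subseteq> {..<\<sigma>}" "length y < length s"
  shows "width (c # y) = rank c (bwt \<pi> s) (start y + width y) - rank c (bwt \<pi> s) (start y)"
proof -
  let ?F = "filter (prefix y) M"
  obtain A C where AC: "M = A @ ?F @ C" "length A = start y"
    using block y by (metis less_imp_le)
  have B: "bwt \<pi> s = map last A @ map last ?F @ map last C"
    unfolding bwt_def by (subst AC(1)) simp
  have "rank c (bwt \<pi> s) (start y) = count_list (map last A) c"
    unfolding rank_def B using AC(2) by simp
  moreover have "rank c (bwt \<pi> s) (start y + width y) = count_list (map last A) c + count_list (map last ?F) c"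
    unfolding rank_def B using AC(2) by (simp add: width_def)
  ultimately have "rank c (bwt \<pi> s) (start y + width y) - rank c (bwt \<pi> s) (start y)
      = count_list (map last ?F) c" by simp
  also have "\<dots> = length (filter (\<lambda>u. prefix y u \<and> last u = c) M)"
    by (simp add: count_list_eq_length_filter filter_map filter_filter o_def eq_commute conj_commute)
  also have "\<dots> = size (filter_mset (\<lambda>u. prefix y u \<and> last u = c) (mset (rotations s)))"
    by (metis mset_M mset_filter size_mset)
  also have "\<dots> = size (filter_mset (\<lambda>u. prefix y u \<and> last u = c) (image_mset rotate1 (mset (rotations s))))"
    by (simp only: mset_rotations_rotate1)
  also have "\<dots> = size (filter_mset (\<lambda>u. prefix y (rotate1 u) \<and> last (rotate1 u) = c) (mset (rotations s)))"
    by (simp add: filter_mset_image_mset)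
  also have "\<dots> = size (filter_mset (prefix (c # y)) (mset (rotations s)))"
  proof -
    have "prefix y (rotate1 u) \<and> last (rotate1 u) = c \<longleftrightarrow> prefix (c # y) u"
      if "u \<in> set (rotations s)" for u
    proof -
      have "length u = length s" using rotations_props(1) that by blast
      \<comment> \<open>Here \<open>length y < length s\<close> matters:
        \<open>rotate1 (a # v)\<close> is \<open>v @ [a]\<close>, and \<open>y\<close> has to fit
        into \<open>v\<close> without reaching the final \<open>a\<close>.\<close>
      then obtain a v where "u = a # v" "length y \<le> length v"
        using y(2) by (cases u) auto
      then show ?thesis by (auto dest: prefix_length_le)
    qed
    then show ?thesis by (intro arg_cong[of _ _ size] filter_mset_cong) auto
  qed
  also have "\<dots> = width (c # y)"
    by (metis mset_M mset_filter size_mset width_def)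
  finally show ?thesis by simp
qed

end

subsection \<open>A calculus for the word RAM\<close>

text \<open>\<open>T\<close> is the time elapsed before the program starts; the postcondition sees the time elapsed
  when it ends.\<close>

definition wp ::
  "nat \<Rightarrow> nat \<Rightarrow> nat \<Rightarrow> nat list \<Rightarrow> (nat list \<Rightarrow> nat list) \<Rightarrow> nat list \<Rightarrow> 'r prog \<Rightarrow>
     (('r \<Rightarrow> nat) \<Rightarrow> (nat \<Rightarrow> nat) \<Rightarrow> nat \<Rightarrow> bool) \<Rightarrow> ('r \<Rightarrow> nat) \<Rightarrow> (nat \<Rightarrow> nat) \<Rightarrow> nat \<Rightarrow> bool"
where
  "wp w m \<sigma> B \<pi> x P Q R H T \<longleftrightarrow>
     (\<exists>t R' H'. exec w m \<sigma> B \<pi> x P (R, H) t (R', H') \<and> Q R' H' (T + t))"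

lemma wp_Skip: "wp w m \<sigma> B \<pi> x Skip Q R H T \<longleftrightarrow> Q R H (T + 1)"
  unfolding wp_def by (auto simp: exec.simps[of w m \<sigma> B \<pi> x Skip])

lemma wp_Const: "wp w m \<sigma> B \<pi> x (Const d a) Q R H T \<longleftrightarrow> Q (R(d := a mod 2 ^ w)) H (T + 1)"
  unfolding wp_def by (auto simp: exec.simps[of w m \<sigma> B \<pi> x "Const d a"])

lemma wp_Op:
  "wp w m \<sigma> B \<pi> x (Op f d a b) Q R H T \<longleftrightarrow> Q (R(d := binop_val w f (R a) (R b))) H (T + 1)"
  unfolding wp_def by (auto simp: exec.simps[of w m \<sigma> B \<pi> x "Op f d a b"])

lemma wp_Load:
  "wp w m \<sigma> B \<pi> x (Load d a) Q R H T \<longleftrightarrow> R a < m \<and> Q (R(d := H (R a))) H (T + 1)"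
  unfolding wp_def by (auto simp: exec.simps[of w m \<sigma> B \<pi> x "Load d a"])

lemma wp_Store:
  "wp w m \<sigma> B \<pi> x (Store a b) Q R H T \<longleftrightarrow> R a < m \<and> Q R (H(R a := R b)) (T + 1)"
  unfolding wp_def by (auto simp: exec.simps[of w m \<sigma> B \<pi> x "Store a b"])

lemma wp_Symbol:
  "wp w m \<sigma> B \<pi> x (Symbol d i) Q R H T \<longleftrightarrow> R i < length x \<and> Q (R(d := x ! R i)) H (T + 1)"
  unfolding wp_def by (auto simp: exec.simps[of w m \<sigma> B \<pi> x "Symbol d i"])

lemma wp_Rank:
  "wp w m \<sigma> B \<pi> x (Rank d c i) Q R H T \<longleftrightarrow>
     R c < \<sigma> \<and> R i \<le> length B \<and> Q (R(d := rank (R c) B (R i))) H (T + 1)"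
  unfolding wp_def by (auto simp: exec.simps[of w m \<sigma> B \<pi> x "Rank d c i"])

lemma wp_Perm:
  "wp w m \<sigma> B \<pi> x (Perm d i j k) Q R H T \<longleftrightarrow>
     R i \<le> R j \<and> R j \<le> length x \<and> R k < \<sigma> \<and>
     Q (R(d := \<pi> (drop (R i) (take (R j) x)) ! R k)) H (T + 1)"
  unfolding wp_def by (auto simp: exec.simps[of w m \<sigma> B \<pi> x "Perm d i j k"])

text \<open>Stated without the state arguments so that unfolding it does not eta-expand the
  continuation.\<close>

lemma wp_Seq:
  "wp w m \<sigma> B \<pi> x (Seq P P') Q = wp w m \<sigma> B \<pi> x P (wp w m \<sigma> B \<pi> x P' Q)"
proof (intro ext iffI)
  fix R H T
  assume "wp w m \<sigma> B \<pi> x (Seq P P') Q R H T"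
  then obtain t R' H' where *: "exec w m \<sigma> B \<pi> x (Seq P P') (R, H) t (R', H')" "Q R' H' (T + t)"
    by (auto simp: wp_def)
  from *(1) show "wp w m \<sigma> B \<pi> x P (wp w m \<sigma> B \<pi> x P' Q) R H T"
  proof cases
    case (Seq t1 S t2)
    then show ?thesis
      using *(2) unfolding wp_def by (metis add.assoc surj_pair)
  qed
next
  fix R H T
  assume "wp w m \<sigma> B \<pi> x P (wp w m \<sigma> B \<pi> x P' Q) R H T"
  then show "wp w m \<sigma> B \<pi> x (Seq P P') Q R H T"
    unfolding wp_def by (metis add.assoc exec.Seq)
qed

lemma wp_If:
  "wp w m \<sigma> B \<pi> x (If b P P') Q R H T \<longleftrightarrow>
     (if test_val b R then wp w m \<sigma> B \<pi> x P Q R H (T + 1) else wp w m \<sigma> B \<pi> x P' Q R H (T + 1))"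
  (is "?L \<longleftrightarrow> ?R")
proof
  assume ?L
  then obtain t R' H' where *: "exec w m \<sigma> B \<pi> x (If b P P') (R, H) t (R', H')" "Q R' H' (T + t)"
    by (auto simp: wp_def)
  from *(1) show ?R
    by cases (use *(2) in \<open>auto simp: wp_def\<close>)
next
  assume ?R
  then show ?L
    unfolding wp_def using exec.IfTrue[of b "(R, H)"] exec.IfFalse[of b "(R, H)"]
    by (simp split: if_splits) (metis add_Suc_right)+
qed

text \<open>Total correctness: the measure \<open>f\<close> gives termination. The time
  \<open>T\<close> is an argument of the invariant, so running-time bounds are proved like any other
  invariant; each test costs the \<open>+ 1\<close>.\<close>

lemma wp_While:
  fixes f :: "('r \<Rightarrow> nat) \<Rightarrow> nat"
  assumes inv: "I R H T"
    and step: "\<And>R H T. I R H T \<Longrightarrow> test_val b R \<Longrightarrow>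
      wp w m \<sigma> B \<pi> x P (\<lambda>R' H' T'. I R' H' T' \<and> f R' < f R) R H (T + 1)"
    and exit: "\<And>R H T. I R H T \<Longrightarrow> \<not> test_val b R \<Longrightarrow> Q R H (T + 1)"
  shows "wp w m \<sigma> B \<pi> x (While b P) Q R H T"
  using inv
proof (induction "f R" arbitrary: R H T rule: less_induct)
  case less
  show ?case
  proof (cases "test_val b R")
    case True
    then obtain t R' H' where *: "exec w m \<sigma> B \<pi> x P (R, H) t (R', H')"
      "I R' H' (T + 1 + t)" "f R' < f R"
      using step[OF less.prems] unfolding wp_def by blast
    then obtain t' R'' H'' where "exec w m \<sigma> B \<pi> x (While b P) (R', H') t' (R'', H'')"
      "Q R'' H'' (T + 1 + t + t')"
      using less.hyps[of R' H' "T + 1 + t"] unfolding wp_def by blast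
    then show ?thesis
      using exec.WhileTrue[of b "(R, H)"] True *(1) unfolding wp_def
      by (metis add.assoc fst_conv)
  next
    case False
    then show ?thesis
      using exit[OF less.prems] exec.WhileFalse[of b "(R, H)"] unfolding wp_def by (metis fst_conv)
  qed
qed

lemmas wp_simps = wp_Skip wp_Const wp_Op wp_Load wp_Store wp_Symbol wp_Rank wp_Perm wp_Seq wp_If

subsection \<open>The program\<close>

text \<open>
  Registers: 0 is \<open>|s|\<close>, 1 is \<open>\<sigma>\<close>, 2 is \<open>|x|\<close>, 3 and 4 are the constants 0 and 1, 5 is \<open>j\<close>,
  6 is \<open>i\<close>, 7 a symbol, 8 an index into an ordering, 9 an address, 10 and 11 are scratch, 12 is a
  running sum of widths, 13 is \<open>x\<^sub>i\<close>, and 14 the width of the range computed last. With \<open>y\<close> the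
  factor of \<open>x\<close> from \<open>i\<close> to \<open>j\<close> exclusive, memory cells \<open>c\<close> and \<open>\<sigma> + c\<close> hold the width and start
  of the range of \<open>y c\<close>, and cell \<open>2\<sigma> + i\<close> holds the start of the range of \<open>y\<close>.
\<close>

definition symbol_widths :: "nat prog" where
  "symbol_widths =
    Seq (Const 7 0)
    (While (Less 7 1)
      (Seq (Rank 10 7 0)
      (Seq (Store 7 10)
           (Op Add 7 7 4))))"

definition extend_widths :: "nat prog" where
  "extend_widths =
    Seq (Symbol 13 6)
    (Seq (Const 7 0)
    (While (Less 7 1)
      (Seq (Op Add 9 1 7)
      (Seq (Load 10 9)
      (Seq (Load 11 7)
      (Seq (Op Add 11 10 11)
      (Seq (Rank 11 13 11)
      (Seq (Rank 10 13 10)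
      (Seq (Op Sub 11 11 10)
      (Seq (Store 7 11)
           (Op Add 7 7 4)))))))))))"

definition set_starts :: "nat prog" where
  "set_starts =
    Seq (Const 8 0)
    (While (Less 8 1)
      (Seq (Perm 7 6 5 8)
      (Seq (Op Add 9 1 7)
      (Seq (Store 9 12)
      (Seq (Load 10 7)
      (Seq (Op Add 12 12 10)
           (Op Add 8 8 4)))))))"

definition factor_step :: "nat prog" where
  "factor_step =
    Seq (Op Sub 6 6 4)
    (Seq (If (Equal 6 5) symbol_widths extend_widths)
    (Seq (Op Add 9 1 1)
    (Seq (Op Add 9 9 6)
    (Seq (Load 12 9)
    (Seq set_starts
    (Seq (Symbol 7 5)
    (Seq (Load 14 7)
    (Seq (Op Add 9 1 7)
    (Seq (Load 10 9)
    (Seq (Op Add 9 1 1)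
    (Seq (Op Add 9 9 6)
         (Store 9 10))))))))))))"

text \<open>Cell \<open>2\<sigma> + j\<close> receives the start 0 of the empty factor. The counter
  enters the loop as \<open>j + 1\<close> because \<open>factor_step\<close> decrements before use,
  so \<open>i = 0\<close> is still processed although words are unsigned.\<close>

definition position_step :: "nat prog" where
  "position_step =
    Seq (Op Add 9 1 1)
    (Seq (Op Add 9 9 5)
    (Seq (Store 9 3)
    (Seq (Op Add 6 5 4)
    (Seq (While (Less 3 6) factor_step)
         (Op Add 5 5 4)))))"

text \<open>Only queries with \<open>1 <= |x| <= |s|\<close> reach the loop; a longer one matches no
  row and the empty one matches all. The closing test restores the convention \<open>[0, 0]\<close>
  for an empty range, whose stored start need not be 0.\<close>

definition Rng_prog :: "nat prog" where
  "Rng_prog =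
    Seq (Const 3 0)
    (Seq (Const 4 1)
    (If (Less 0 2) (Seq (Const 0 0) (Const 1 0))
    (If (Equal 2 3) (Seq (Op Add 1 0 3) (Const 0 0))
      (Seq (Const 5 0)
      (Seq (While (Less 5 2) position_step)
      (Seq (Op Add 9 1 1)
      (Seq (Load 0 9)
      (Seq (Op Add 1 14 3)
           (If (Equal 1 3) (Const 0 0) Skip)))))))))"

section \<open>Correctness and running time of the program\<close>

locale Rng_computation = ctx_bwt +
  fixes w :: nat and x :: "nat list"
  assumes \<sigma>_pos: "1 \<le> \<sigma>"
    and word_size: "word_size_ok w \<sigma> s x"
    and pattern: "set x \<subseteq> {..<\<sigma>}"
    and short: "length x \<le> length s"
    and nonempty: "1 \<le> length x"
begin

abbreviation run where
  "run \<equiv> wp w (2 * \<sigma> + length x) \<sigma> (bwt \<pi> s) \<pi> x"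

definition factor :: "nat \<Rightarrow> nat \<Rightarrow> nat list" where
  "factor i j = drop i (take j x)"

text \<open>No address, counter or row index may wrap around. For positive \<sigma> and
  \<open>|s|\<close>, \<open>2\<sigma> + |s|\<close> exceeds \<open>\<sigma> * (|s| + 1)\<close> by
  at most 1, and the strict bound in \<open>word_size_ok\<close> absorbs that.\<close>

lemma word_bounds:
  "2 * \<sigma> + length x \<le> 2 ^ w" "length s < 2 ^ w" "\<sigma> < 2 ^ w" "length x < 2 ^ w" "1 < (2::nat) ^ w"
proof -
  have le: "\<sigma> * (length s + 1) < 2 ^ w" "length x < 2 ^ w"
    using word_size by (auto simp: word_size_ok_def)
  obtain a b where ab: "\<sigma> = Suc a" "length s = Suc b"
    using \<sigma>_pos short nonempty by (metis One_nat_def Suc_le_D le_trans)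
  have "2 * \<sigma> + length s \<le> \<sigma> * (length s + 1) + 1" "length s + 1 \<le> \<sigma> * (length s + 1)"
       "\<sigma> + 1 \<le> \<sigma> * (length s + 1)"
    unfolding ab by simp_all
  then show "2 * \<sigma> + length x \<le> 2 ^ w" "length s < 2 ^ w" "\<sigma> < 2 ^ w" "length x < 2 ^ w"
    using le short by linarith+
  show "1 < (2::nat) ^ w"
    using le(1) ab by (cases w) auto
qed

lemma factor_self [simp]: "factor j j = []"
  by (simp add: factor_def)

lemma length_factor: "j \<le> length x \<Longrightarrow> length (factor i j) = j - i"
  by (simp add: factor_def)

lemma factor_Cons: "i < j \<Longrightarrow> j < length x \<Longrightarrow> factor i j = x ! i # factor (Suc i) j"
  using Cons_nth_drop_Suc[of i "take j x"] by (simp add: factor_def)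

lemma factor_snoc: "i \<le> j \<Longrightarrow> j < length x \<Longrightarrow> factor i (Suc j) = factor i j @ [x ! j]"
  by (simp add: factor_def take_Suc_conv_app_nth)

lemma set_factor: "set (factor i j) \<subseteq> {..<\<sigma>}"
  unfolding factor_def using pattern by (meson order_trans set_drop_subset set_take_subset)

lemma run_symbol_widths:
  assumes R: "R 0 = length s" "R 1 = \<sigma>" "R 4 = 1"
    and post: "\<And>R' H' T'. \<forall>r. r \<notin> {7, 10} \<longrightarrow> R' r = R r \<Longrightarrow> \<forall>a\<ge>\<sigma>. H' a = H a \<Longrightarrow>
      \<forall>c<\<sigma>. H' c = width [c] \<Longrightarrow> T' \<le> T + 4 * \<sigma> + 2 \<Longrightarrow> Q R' H' T'"
  shows "run symbol_widths Q R H T"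
proof -
  \<comment> \<open>The range of the empty string consists of all rows, and the rank at 0 vanishes,
    so a single query suffices.\<close>
  have width: "width [c] = rank c (bwt \<pi> s) (length s)" for c
  proof -
    have "0 < length s" using short nonempty by linarith
    then show ?thesis using width_Cons[of "[]" c] by (simp add: rank_def)
  qed
  show ?thesis
    unfolding symbol_widths_def wp_Seq wp_Const
  proof (rule wp_While[where f = "\<lambda>R. \<sigma> - R 7" and
        I = "\<lambda>R' H' T'. R' 7 \<le> \<sigma> \<and> (\<forall>r. r \<notin> {7, 10} \<longrightarrow> R' r = R r) \<and>
          (\<forall>a\<ge>\<sigma>. H' a = H a) \<and> (\<forall>c<R' 7. H' c = width [c]) \<and> T' \<le> T + 1 + 4 * R' 7"], goal_cases)
    case 1
    show ?case by simp
  next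
    case (2 R' H' T')
    then show ?case
      using R word_bounds by (auto simp: wp_simps width less_Suc_eq)
  next
    case (3 R' H' T')
    then show ?case
      using R by (intro post) auto
  qed
qed

text \<open>The widths are updated in place. Iteration \<open>c\<close> reads only cells
  \<open>c\<close> and \<open>\<sigma> + c\<close>, which no earlier iteration has written; hence
  the invariant clause that cells from \<open>R' 7\<close> on are unchanged.\<close>

lemma run_extend_widths:
  assumes R: "R 1 = \<sigma>" "R 4 = 1" "R 6 < length x"
    and z: "set z \<subseteq> {..<\<sigma>}" "length z + 1 < length s"
    and H: "\<forall>c<\<sigma>. H c = width (z @ [c]) \<and> H (\<sigma> + c) = start (z @ [c])"
    and post: "\<And>R' H' T'. \<forall>r. r \<notin> {7, 9, 10, 11, 13} \<longrightarrow> R' r = R r \<Longrightarrow> \<forall>a\<ge>\<sigma>. H' a = H a \<Longrightarrow>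
      \<forall>c<\<sigma>. H' c = width (x ! R 6 # z @ [c]) \<Longrightarrow> T' \<le> T + 10 * \<sigma> + 3 \<Longrightarrow> Q R' H' T'"
  shows "run extend_widths Q R H T"
proof -
  let ?xi = "x ! R 6" and ?B = "bwt \<pi> s"
  have xi: "?xi < \<sigma>"
    using R(3) pattern by (meson lessThan_iff nth_mem subsetD)
  have width: "width (?xi # z @ [c]) = rank ?xi ?B (start (z @ [c]) + width (z @ [c])) - rank ?xi ?B (start (z @ [c]))"
    and le: "start (z @ [c]) + width (z @ [c]) \<le> length s" if "c < \<sigma>" for c
    using that z by (auto intro!: width_Cons start_width_le)
  have rank_le: "rank c ?B i \<le> length s" for c i
    unfolding rank_def using count_le_length[of "take i ?B" c] by simp
  have rank_mono: "rank c ?B i \<le> rank c ?B i'" if "i \<le> i'" for c i i'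
  proof -
    have "take i' ?B = take i ?B @ take (i' - i) (drop i ?B)"
      using that by (metis le_add_diff_inverse take_add)
    then show ?thesis by (simp add: rank_def)
  qed
  \<comment> \<open>Machine subtraction adds \<open>2 ^ w\<close> and reduces; since rank is
    monotone and fits in a word, the result is the true difference.\<close>
  have sub: "(rank c ?B i' + 2 ^ w - rank c ?B i) mod 2 ^ w = rank c ?B i' - rank c ?B i"
    if "i \<le> i'" for c i i'
  proof -
    have "rank c ?B i' + 2 ^ w - rank c ?B i = (rank c ?B i' - rank c ?B i) + 2 ^ w"
      using rank_mono[OF that, of c] by simp
    moreover have "rank c ?B i' - rank c ?B i < 2 ^ w"
      using rank_le[of c i'] word_bounds(2) by linarith
    ultimately show ?thesis by (simp only: mod_add_self2 mod_less)
  qed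
  show ?thesis
    unfolding extend_widths_def wp_Seq wp_Const wp_Symbol
  proof (intro conjI, rule R(3), rule wp_While[where f = "\<lambda>R. \<sigma> - R 7" and
        I = "\<lambda>R' H' T'. R' 7 \<le> \<sigma> \<and> (\<forall>r. r \<notin> {7, 9, 10, 11, 13} \<longrightarrow> R' r = R r) \<and> R' 13 = ?xi \<and>
          (\<forall>a\<ge>R' 7. H' a = H a) \<and> (\<forall>c<R' 7. H' c = width (?xi # z @ [c])) \<and>
          T' \<le> T + 2 + 10 * R' 7"], goal_cases)
    case 1
    show ?case by simp
  next
    case (2 R' H' T')
    let ?c = "R' 7"
    have c: "?c < \<sigma>" using 2 R by simp
    have regs: "R' 1 = \<sigma>" "R' 4 = 1" "R' 13 = ?xi" using 2 R by simp_all
    have mem: "H' ?c = width (z @ [?c])" "H' (\<sigma> + ?c) = start (z @ [?c])"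
      using 2 H c by simp_all
    have "\<sigma> + ?c < 2 * \<sigma> + length x" "\<sigma> + ?c < 2 ^ w" "Suc ?c < 2 ^ w" "?c < 2 * \<sigma> + length x"
      "start (z @ [?c]) + width (z @ [?c]) < 2 ^ w" "start (z @ [?c]) \<le> length s"
      using c word_bounds(1-3) le[OF c] by linarith+
    then show ?case
      using 2 regs mem xi le[OF c]
      by (auto simp: wp_simps sub width[OF c] less_Suc_eq)
  next
    case (3 R' H' T')
    then show ?case
      using R by (intro post) auto
  qed
qed

text \<open>Visiting the symbols in the order \<open>\<pi> y\<close> makes the running sum in
  register 12 the start of each child in turn.\<close>

lemma run_set_starts:
  assumes R: "R 1 = \<sigma>" "R 4 = 1" "R 6 \<le> R 5" "R 5 < length x" "R 12 = start y"
    and y: "y = factor (R 6) (R 5)"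
    and H: "\<forall>c<\<sigma>. H c = width (y @ [c])"
    and post: "\<And>R' H' T'. \<forall>r. r \<notin> {7, 8, 9, 10, 12} \<longrightarrow> R' r = R r \<Longrightarrow>
      \<forall>a. a < \<sigma> \<or> 2 * \<sigma> \<le> a \<longrightarrow> H' a = H a \<Longrightarrow>
      \<forall>c<\<sigma>. H' (\<sigma> + c) = start (y @ [c]) \<Longrightarrow> T' \<le> T + 7 * \<sigma> + 2 \<Longrightarrow> Q R' H' T'"
  shows "run set_starts Q R H T"
proof -
  let ?S = "\<lambda>k. start y + (\<Sum>d\<leftarrow>take k (\<pi> y). width (y @ [d]))"
  have set_y: "set y \<subseteq> {..<\<sigma>}" unfolding y by (rule set_factor)
  have len_y: "length y < length s"
    using R short by (simp add: y length_factor)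
  note ord = set_ordering[OF set_y] distinct_ordering[OF set_y] length_ordering[OF set_y]
  \<comment> \<open>Partial sums are bounded by the full sum \<open>width y\<close>, so the
    accumulator never exceeds \<open>length s\<close> and cannot overflow.\<close>
  have S_le: "?S k \<le> length s" for k
  proof -
    have "(\<Sum>d\<leftarrow>take k (\<pi> y). width (y @ [d])) \<le> (\<Sum>d\<leftarrow>take k (\<pi> y) @ drop k (\<pi> y). width (y @ [d]))"
      unfolding map_append sum_list_append by simp
    also have "\<dots> = width y"
      using sum_width_children[OF set_y len_y] by simp
    finally show ?thesis
      using start_width_le[OF set_y] len_y by linarith
  qed
  have S_Suc: "?S (Suc k) = ?S k + width (y @ [\<pi> y ! k])" if "k < \<sigma>" for k
    using that ord(3) by (simp add: take_Suc_conv_app_nth)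
  show ?thesis
    unfolding set_starts_def wp_Seq wp_Const
  proof (rule wp_While[where f = "\<lambda>R. \<sigma> - R 8" and
        I = "\<lambda>R' H' T'. R' 8 \<le> \<sigma> \<and> (\<forall>r. r \<notin> {7, 8, 9, 10, 12} \<longrightarrow> R' r = R r) \<and>
          R' 12 = ?S (R' 8) \<and> (\<forall>a. a < \<sigma> \<or> 2 * \<sigma> \<le> a \<longrightarrow> H' a = H a) \<and>
          (\<forall>k<R' 8. H' (\<sigma> + \<pi> y ! k) = start (y @ [\<pi> y ! k])) \<and> T' \<le> T + 1 + 7 * R' 8"], goal_cases)
    case 1
    show ?case using R by simp
  next
    case (2 R' H' T')
    let ?k = "R' 8"
    let ?c = "\<pi> y ! ?k"
    have k: "?k < \<sigma>" using 2 R by simp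
    then have c: "?c < \<sigma>" using ord by (metis lessThan_iff nth_mem)
    have regs: "R' 1 = \<sigma>" "R' 4 = 1" "R' 5 = R 5" "R' 6 = R 6" using 2 R by simp_all
    have mem: "H' ?c = width (y @ [?c])"
      using 2 H c by simp
    have bounds: "\<sigma> + ?c < 2 * \<sigma> + length x" "\<sigma> + ?c < 2 ^ w" "Suc ?k < 2 ^ w" "?c < 2 * \<sigma> + length x"
      "?S ?k + width (y @ [?c]) < 2 ^ w"
      using c k word_bounds(1-3) S_le[of "Suc ?k"] S_Suc[OF k] by linarith+
    \<comment> \<open>The ordering has no repetitions, so this store does not overwrite a start
      recorded earlier.\<close>
    have inj: "\<pi> y ! k' \<noteq> ?c" if "k' < ?k" for k'
      using that k ord by (simp add: nth_eq_iff_index_eq)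
    show ?case
      using 2 regs mem R(3,4) k c bounds S_Suc[OF k] start_snoc_nth[OF set_y k] inj
      unfolding wp_simps
      by (simp add: y[unfolded factor_def, symmetric] less_Suc_eq)
  next
    case (3 R' H' T')
    have "R' 8 = \<sigma>" using 3 R by simp
    have "H' (\<sigma> + c) = start (y @ [c])" if c: "c < \<sigma>" for c
    proof -
      obtain k where "k < \<sigma>" "\<pi> y ! k = c"
        using c ord(1,3) by (metis in_set_conv_nth lessThan_iff)
      then show ?thesis using 3 \<open>R' 8 = \<sigma>\<close> by auto
    qed
    then show ?case
      using 3 \<open>R' 8 = \<sigma>\<close> by (intro post) auto
  qed
qed

lemma nth_pattern_less: "i < length x \<Longrightarrow> x ! i < \<sigma>"
  using pattern by (meson lessThan_iff nth_mem subsetD)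

text \<open>State in round \<open>j\<close>, where \<open>i\<close> is the left end handled last;
  \<open>i = Suc j\<close> means none yet, hence the guard on the widths and starts. The array from
  \<open>2\<sigma>\<close> on is in transition: cells below \<open>i\<close> still serve round
  \<open>j\<close>, those from \<open>i\<close> to \<open>j\<close> already serve round
  \<open>Suc j\<close>.\<close>

definition factor_inv :: "nat \<Rightarrow> nat \<Rightarrow> (nat \<Rightarrow> nat) \<Rightarrow> (nat \<Rightarrow> nat) \<Rightarrow> bool" where
  "factor_inv j i R H \<longleftrightarrow>
     R 0 = length s \<and> R 1 = \<sigma> \<and> R 2 = length x \<and> R 3 = 0 \<and> R 4 = 1 \<and> R 5 = j \<and> R 6 = i \<and>
     i \<le> Suc j \<and> j < length x \<and>
     (i \<le> j \<longrightarrow> R 14 = width (factor i (Suc j)) \<and>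
       (\<forall>c<\<sigma>. H c = width (factor i j @ [c]) \<and> H (\<sigma> + c) = start (factor i j @ [c]))) \<and>
     (\<forall>a<i. H (2 * \<sigma> + a) = start (factor a j)) \<and>
     (\<forall>a. i \<le> a \<and> a \<le> j \<longrightarrow> H (2 * \<sigma> + a) = start (factor a (Suc j)))"

lemma run_factor_widths:
  assumes inv: "factor_inv j (Suc i) R H"
    and post: "\<And>R' H' T'. \<forall>r. r \<notin> {7, 9, 10, 11, 13} \<longrightarrow> R' r = (R(6 := i)) r \<Longrightarrow>
      \<forall>a\<ge>\<sigma>. H' a = H a \<Longrightarrow> \<forall>c<\<sigma>. H' c = width (factor i j @ [c]) \<Longrightarrow>
      T' \<le> T + 10 * \<sigma> + 4 \<Longrightarrow> Q R' H' T'"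
  shows "run (If (Equal 6 5) symbol_widths extend_widths) Q (R(6 := i)) H T"
proof (cases "i = j")
  case True
  have "run symbol_widths Q (R(6 := i)) H (T + 1)"
  proof (rule run_symbol_widths, goal_cases)
    case (4 R' H' T')
    then show ?case
      using inv True by (intro post) (auto simp: factor_inv_def)
  qed (use inv in \<open>auto simp: factor_inv_def\<close>)
  then show ?thesis
    using True inv by (simp add: wp_If factor_inv_def)
next
  case False
  then have ij: "i < j" "j < length x"
    using inv by (auto simp: factor_inv_def)
  have "run extend_widths Q (R(6 := i)) H (T + 1)"
  proof (rule run_extend_widths[where z = "factor (Suc i) j"], goal_cases)
    case 4
    show ?case by (rule set_factor)
  next
    case 5
    show ?case using ij short by (simp add: length_factor)
  next
    case (7 R' H' T')
    then show ?case
      using ij by (intro post) (auto simp: factor_Cons)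
  qed (use inv ij in \<open>auto simp: factor_inv_def\<close>)
  then show ?thesis
    using False inv by (simp add: wp_If factor_inv_def)
qed

lemma run_factor_step:
  assumes inv: "factor_inv j (Suc i) R H"
  shows "run factor_step (\<lambda>R' H' T'. factor_inv j i R' H' \<and> T' \<le> T + 17 * \<sigma> + 20) R H T"
proof -
  have ij: "i \<le> j" "j < length x"
    using inv by (auto simp: factor_inv_def)
  have regs: "R 0 = length s" "R 1 = \<sigma>" "R 2 = length x" "R 3 = 0" "R 4 = 1" "R 5 = j" "R 6 = Suc i"
    using inv by (auto simp: factor_inv_def)
  have bounds: "\<sigma> + \<sigma> < 2 ^ w" "\<sigma> + \<sigma> + i < 2 ^ w" "i < 2 ^ w" "x ! j < \<sigma>" "\<sigma> + x ! j < 2 ^ w"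
    "\<sigma> + x ! j < 2 * \<sigma> + length x" "x ! j < 2 * \<sigma> + length x" "\<sigma> + \<sigma> + i < 2 * \<sigma> + length x"
    using word_bounds nth_pattern_less[OF ij(2)] ij by linarith+
  have sub: "(Suc i + 2 ^ w - 1) mod 2 ^ w = i"
    using bounds(3) by simp
  show ?thesis
    unfolding factor_step_def wp_Seq
  proof (subst wp_Op, unfold binop_val.simps regs sub, rule run_factor_widths[OF inv], goal_cases)
    case (1 R1 H1 T1)
    have regs1: "R1 0 = length s" "R1 1 = \<sigma>" "R1 2 = length x" "R1 3 = 0" "R1 4 = 1" "R1 5 = j" "R1 6 = i"
      using 1 regs by auto
    have H1: "H1 (2 * \<sigma> + a) = H (2 * \<sigma> + a)" for a
      using 1 by simp
    \<comment> \<open>Cell \<open>2\<sigma> + i\<close> is not yet updated: it holds the start found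
      in the previous round or, if \<open>i = j\<close>, the 0 stored when this round began.\<close>
    have acc: "H1 (\<sigma> + \<sigma> + i) = start (factor i j)"
      using H1[of i] inv by (simp add: factor_inv_def mult_2)
    have "run set_starts (run
        (Seq (Symbol 7 5) (Seq (Load 14 7) (Seq (Op Add 9 1 7) (Seq (Load 10 9)
          (Seq (Op Add 9 1 1) (Seq (Op Add 9 9 6) (Store 9 10)))))))
        (\<lambda>R' H' T'. factor_inv j i R' H' \<and> T' \<le> T + 17 * \<sigma> + 20))
      (R1(9 := \<sigma> + \<sigma> + i, 12 := start (factor i j))) H1 (T1 + 1 + 1 + 1)"
    proof (rule run_set_starts[where y = "factor i j"], goal_cases)
      case (8 R2 H2 T2)
      have regs2: "R2 0 = length s" "R2 1 = \<sigma>" "R2 2 = length x" "R2 3 = 0" "R2 4 = 1" "R2 5 = j" "R2 6 = i"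
        using 8(1) regs1 by auto
      have width2: "H2 c = width (factor i j @ [c])" if "c < \<sigma>" for c
        using 8(2) 1(3) that by simp
      have start2: "H2 (\<sigma> + c) = start (factor i j @ [c])" if "c < \<sigma>" for c
        using 8(3) that by simp
      have D2: "H2 (2 * \<sigma> + a) = H (2 * \<sigma> + a)" for a
        using 8(2) H1 by simp
      \<comment> \<open>The entries for the symbol \<open>x ! j\<close> describe
        \<open>factor i (Suc j)\<close>; its start replaces the old one for use in the next
        round.\<close>
      let ?R = "R2(7 := x ! j, 14 := width (factor i (Suc j)), 9 := \<sigma> + \<sigma> + i, 10 := start (factor i (Suc j)))"
      let ?H = "H2(2 * \<sigma> + i := start (factor i (Suc j)))"
      have "factor_inv j i ?R ?H"
        unfolding factor_inv_def using regs2 ij width2 start2 D2 inv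
        by (auto simp: factor_inv_def)
      moreover have "T2 + 7 \<le> T + 17 * \<sigma> + 20"
        using 8(4) 1(4) by simp
      ultimately show ?case
        using bounds regs2 ij width2[OF bounds(4)] start2[OF bounds(4)]
        by (simp add: wp_simps factor_snoc mult_2 fun_upd_twist)
    qed (use regs1 ij 1 in auto)
    then show ?case
      using regs1 bounds acc by (simp add: wp_simps)
  qed
qed

text \<open>A round ends with \<open>i = 0\<close>, so the width left in register 14 belongs to a
  prefix of \<open>x\<close>.\<close>

definition position_inv :: "nat \<Rightarrow> (nat \<Rightarrow> nat) \<Rightarrow> (nat \<Rightarrow> nat) \<Rightarrow> bool" where
  "position_inv j R H \<longleftrightarrow>
     R 0 = length s \<and> R 1 = \<sigma> \<and> R 2 = length x \<and> R 3 = 0 \<and> R 4 = 1 \<and> R 5 = j \<and> j \<le> length x \<and>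
     (0 < j \<longrightarrow> R 14 = width (take j x)) \<and> (\<forall>a<j. H (2 * \<sigma> + a) = start (factor a j))"

lemma run_position_step:
  assumes inv: "position_inv j R H" and j: "j < length x"
  shows "run position_step
    (\<lambda>R' H' T'. position_inv (Suc j) R' H' \<and> T' \<le> T + Suc j * (17 * \<sigma> + 21) + 6) R H T"
proof -
  have regs: "R 0 = length s" "R 1 = \<sigma>" "R 2 = length x" "R 3 = 0" "R 4 = 1" "R 5 = j"
    using inv by (auto simp: position_inv_def)
  have bounds: "\<sigma> + \<sigma> < 2 ^ w" "\<sigma> + \<sigma> + j < 2 ^ w" "Suc j < 2 ^ w" "\<sigma> + \<sigma> + j < 2 * \<sigma> + length x"
    using word_bounds j by linarith+
  let ?R = "R(9 := \<sigma> + \<sigma> + j, 6 := Suc j)" and ?H = "H(\<sigma> + \<sigma> + j := 0)"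
  have "factor_inv j (Suc j) ?R ?H"
    using inv j by (auto simp: factor_inv_def position_inv_def mult_2 less_Suc_eq)
  then have "run (While (Less 3 6) factor_step) (run (Op Add 5 5 4)
      (\<lambda>R' H' T'. position_inv (Suc j) R' H' \<and> T' \<le> T + Suc j * (17 * \<sigma> + 21) + 6)) ?R ?H (T + 1 + 1 + 1 + 1)"
  \<comment> \<open>Each of the \<open>Suc j\<close> passes costs at most
    \<open>17 * \<sigma> + 20\<close>, and its test one more. The 6 in the goal pays for the four
    instructions before the loop, the failing test and the final addition.\<close>
  proof (intro wp_While[where f = "\<lambda>R. R 6" and
        I = "\<lambda>R' H' T'. factor_inv j (R' 6) R' H' \<and>
          T' \<le> T + 4 + (Suc j - R' 6) * (17 * \<sigma> + 21)"], goal_cases)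
    case 1
    then show ?case by simp
  next
    case (2 R' H' T')
    then have "0 < R' 6"
      by (simp add: factor_inv_def)
    then obtain i where i: "R' 6 = Suc i"
      by (cases "R' 6") auto
    have le: "i \<le> j" using 2 i by (auto simp: factor_inv_def)
    have *: "factor_inv j (R'' 6) R'' H'' \<and> T'' \<le> T + 4 + (Suc j - R'' 6) * (17 * \<sigma> + 21) \<and> R'' 6 < R' 6"
      if "factor_inv j i R'' H'' \<and> T'' \<le> T' + 1 + 17 * \<sigma> + 20" for R'' H'' T''
    proof -
      have "R'' 6 = i" using that by (auto simp: factor_inv_def)
      moreover have "Suc j - i = Suc (Suc j - Suc i)" using le by simp
      ultimately show ?thesis using that 2 i by simp
    qed
    have "run factor_step (\<lambda>R'' H'' T''. factor_inv j i R'' H'' \<and> T'' \<le> T' + 1 + 17 * \<sigma> + 20) R' H' (T' + 1)"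
      using run_factor_step[of j i R' H' "T' + 1"] 2 i by simp
    then show ?case
      unfolding wp_def using * by (metis (no_types, lifting))
  next
    case (3 R' H' T')
    then have "R' 6 = 0" "factor_inv j 0 R' H'" by (auto simp: factor_inv_def)
    then have "position_inv (Suc j) (R'(5 := Suc j)) H'"
      using j by (auto simp: factor_inv_def position_inv_def factor_def less_Suc_eq_le)
    then show ?case
      using 3 \<open>R' 6 = 0\<close> bounds by (simp add: wp_Op factor_inv_def)
  qed
  then show ?thesis
    unfolding position_step_def using regs bounds by (simp add: wp_simps fun_upd_twist)
qed

lemma run_Rng_prog:
  assumes R: "R 0 = length s" "R 1 = \<sigma>" "R 2 = length x"
  shows "run Rng_prog (\<lambda>R' H' T'. is_Rng M x (R' 0) (R' 1) \<and>
    T' \<le> length x * (length x * (17 * \<sigma> + 21) + 7) + 12) R H 0"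
proof -
  let ?K = "length x * (17 * \<sigma> + 21) + 7"
  let ?R = "R(3 := 0, 4 := 1, 5 := 0)"
  let ?tail = "Seq (Op Add 9 1 1) (Seq (Load 0 9) (Seq (Op Add 1 14 3)
      (If (Equal 1 3) (Const 0 0) Skip)))"
  let ?Q = "\<lambda>R' H' T'. is_Rng M x (R' 0) (R' 1) \<and> T' \<le> length x * ?K + 12"
  have "position_inv 0 ?R H"
    using R by (simp add: position_inv_def)
  then have "run (While (Less 5 2) position_step) (run ?tail ?Q) ?R H 5"
  proof (intro wp_While[where f = "\<lambda>R. length x - R 5" and
        I = "\<lambda>R' H' T'. position_inv (R' 5) R' H' \<and> T' \<le> 5 + R' 5 * ?K"], goal_cases)
    case 1
    then show ?case by simp
  next
    case (2 R' H' T')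
    let ?j = "R' 5"
    have j: "?j < length x" using 2 by (simp add: position_inv_def)
    have *: "position_inv (R'' 5) R'' H'' \<and> T'' \<le> 5 + R'' 5 * ?K \<and> length x - R'' 5 < length x - ?j"
      if "position_inv (Suc ?j) R'' H'' \<and> T'' \<le> T' + 1 + Suc ?j * (17 * \<sigma> + 21) + 6" for R'' H'' T''
    proof -
      \<comment> \<open>Every round is charged as if it were the longest, which preserves the
        quadratic order.\<close>
      have "Suc ?j * (17 * \<sigma> + 21) \<le> length x * (17 * \<sigma> + 21)"
        using j by (intro mult_right_mono) auto
      then have "T'' \<le> 5 + Suc ?j * ?K" using that 2 by simp
      moreover have "R'' 5 = Suc ?j" using that by (simp add: position_inv_def)
      ultimately show ?thesis using that j by simp
    qed
    have "run position_step (\<lambda>R'' H'' T''. position_inv (Suc ?j) R'' H'' \<and>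
        T'' \<le> T' + 1 + Suc ?j * (17 * \<sigma> + 21) + 6) R' H' (T' + 1)"
      using run_position_step[of ?j R' H' "T' + 1"] 2 j by blast
    then show ?case
      unfolding wp_def using * by (metis (no_types, lifting))
  next
    case (3 R' H' T')
    have j: "R' 5 = length x" using 3 by (auto simp: position_inv_def)
    have regs: "R' 1 = \<sigma>" "R' 3 = 0" "R' 14 = width x"
      and "\<forall>a<length x. H' (2 * \<sigma> + a) = start (factor a (length x))"
      using 3 j nonempty by (auto simp: position_inv_def)
    \<comment> \<open>Cell \<open>2\<sigma> + 0\<close> belongs to the factor from 0 to
      \<open>length x\<close>, which is \<open>x\<close> itself.\<close>
    from this(4) have start: "H' (\<sigma> + \<sigma>) = start x"
      using nonempty by (auto simp: factor_def mult_2 dest: spec[of _ 0])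
    have bounds: "\<sigma> + \<sigma> < 2 ^ w" "\<sigma> + \<sigma> < 2 * \<sigma> + length x" "width x < 2 ^ w"
      using word_bounds nonempty start_width_le[OF pattern short] by linarith+
    show ?case
      using 3 j regs start bounds is_Rng_start_width[OF pattern short]
      by (auto simp: wp_simps)
  qed
  then show ?thesis
    unfolding Rng_prog_def using R short nonempty word_bounds(5)
    by (auto simp: wp_simps numeral_eq_Suc)
qed

end

section \<open>Degenerate queries and the final bounds\<close>

lemma run_Rng_prog_trivial:
  assumes R: "R 0 = length s" "R 1 = \<sigma>" "R 2 = length x"
    and w: "1 < (2::nat) ^ w" "length s < 2 ^ w"
    and x: "length s < length x \<or> x = []"
  shows "wp w m \<sigma> B \<pi> x Rng_prog (\<lambda>R' H' T'. R' 0 = 0 \<and>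
    R' 1 = (if x = [] then length s else 0) \<and> T' \<le> 10) R H 0"
proof (cases "x = []")
  case True
  then show ?thesis
    using R w unfolding Rng_prog_def by (simp add: wp_simps)
next
  case False
  then show ?thesis
    using x R w unfolding Rng_prog_def by (simp add: wp_simps)
qed

lemma card_regs_Rng_prog: "card (regs Rng_prog) \<le> 15"
proof -
  have "regs Rng_prog \<subseteq> {..<15}"
    by (auto simp: Rng_prog_def position_step_def factor_step_def set_starts_def
        extend_widths_def symbol_widths_def)
  then show ?thesis
    using card_mono[of "{..<15}"] by fastforce
qed

theorem theorem6:
  fixes k :: nat
  shows "\<exists>(P :: nat prog) (C :: nat). \<forall>w \<sigma> s \<pi> x.
           1 \<le> \<sigma> \<longrightarrow> \<sigma> \<le> w ^ k \<longrightarrow> word_size_ok w \<sigma> s x \<longrightarrow>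
           set s \<subseteq> {..<\<sigma>} \<longrightarrow> primitive s \<longrightarrow> context_orderings \<sigma> \<pi> \<longrightarrow>
           set x \<subseteq> {..<\<sigma>} \<longrightarrow>
           computes_Rng P w \<sigma> s \<pi> x
             (C * (\<sigma> * (max 1 (length x))\<^sup>2)) (C * (\<sigma> * max 1 (length x)))"
\<comment> \<open>Any large enough constant serves: the coefficients 17, 21, 7 and 12 of the time
  bound add up to 57, and the space is at most \<open>2 * \<sigma> + length x + 15\<close>.\<close>
proof (intro exI[of _ Rng_prog] exI[of _ 100] allI impI)
  fix w \<sigma> s \<pi> x
  assume \<sigma>: "1 \<le> \<sigma>" and w: "word_size_ok w \<sigma> s x"
    and "set s \<subseteq> {..<\<sigma>}" "primitive s" "context_orderings \<sigma> \<pi>" and x: "set x \<subseteq> {..<\<sigma>}"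
  then interpret ctx_bwt \<sigma> \<pi> s
    by unfold_locales
  let ?p = "max 1 (length x)" and ?m = "2 * \<sigma> + length x"
  have le: "1 \<le> \<sigma> * ?p" "\<sigma> \<le> \<sigma> * ?p" "length x \<le> \<sigma> * ?p"
    using mult_le_mono[OF \<sigma>, of 1 ?p] mult_le_mono2[of 1 ?p \<sigma>] mult_le_mono[OF \<sigma>, of "length x" ?p]
    by (simp_all only: mult_1 mult_1_right max.cobounded1 max.cobounded2)
  have space: "?m + card (regs Rng_prog) \<le> 100 * (\<sigma> * ?p)"
    using le card_regs_Rng_prog by linarith
  have "\<exists>t R' H'. exec w ?m \<sigma> (bwt \<pi> s) \<pi> x Rng_prog (R, H) t (R', H') \<and>
      t \<le> 100 * (\<sigma> * ?p\<^sup>2) \<and> is_Rng M x (R' 0) (R' 1)"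
    if R: "R 0 = length s" "R 1 = \<sigma>" "R 2 = length x" for R H
  proof (cases "length x \<le> length s \<and> 1 \<le> length x")
    case True
    then interpret Rng_computation \<sigma> \<pi> s w x
      using \<sigma> w x by unfold_locales auto
    have "length x * (length x * (17 * \<sigma> + 21) + 7) + 12 \<le> 100 * (\<sigma> * ?p\<^sup>2)"
    proof -
      have p: "?p = length x" using True by simp
      have "length x \<le> \<sigma> * (length x)\<^sup>2" "1 \<le> \<sigma> * (length x)\<^sup>2" "(length x)\<^sup>2 \<le> \<sigma> * (length x)\<^sup>2"
        using True \<sigma> by (auto simp: power2_eq_square Suc_le_eq)
      moreover have "length x * (length x * (17 * \<sigma> + 21) + 7) + 12 =
          17 * (\<sigma> * (length x)\<^sup>2) + 21 * (length x)\<^sup>2 + 7 * length x + 12"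
        by (simp add: power2_eq_square algebra_simps)
      ultimately show ?thesis unfolding p by linarith
    qed
    then show ?thesis
      using run_Rng_prog[OF R, of H] unfolding wp_def by (auto intro: order_trans)
  next
    case False
    have bounds: "1 < (2::nat) ^ w" "length s < 2 ^ w"
    proof -
      have "length s + 1 \<le> \<sigma> * (length s + 1)"
        using mult_le_mono1[OF \<sigma>, of "length s + 1"] by simp
      then show "1 < (2::nat) ^ w" "length s < 2 ^ w"
        using w unfolding word_size_ok_def by linarith+
    qed
    have "is_Rng M x 0 (if x = [] then length s else 0)"
      using False is_Rng_long[of x] is_Rng_start_width[of "[]"]
      by (auto simp: Suc_le_eq split: if_splits)
    moreover have "10 \<le> 100 * (\<sigma> * ?p\<^sup>2)"
    proof -
      have "1 \<le> \<sigma> * ?p\<^sup>2"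
        using \<sigma> by (simp add: Suc_le_eq)
      then show ?thesis by linarith
    qed
    moreover have "length s < length x \<or> x = []"
      using False by (auto simp: Suc_le_eq)
    ultimately show ?thesis
      using run_Rng_prog_trivial[OF R bounds, of ?m "bwt \<pi> s" \<pi> H] unfolding wp_def
      by (fastforce intro: order_trans)
  qed
  then show "computes_Rng Rng_prog w \<sigma> s \<pi> x (100 * (\<sigma> * ?p\<^sup>2)) (100 * (\<sigma> * ?p))"
    unfolding computes_Rng_def using space by (intro exI[of _ ?m]) auto
qed

end
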